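(* Let $\{(x^k,y^k,\lambda^k)\}_{k\ge 0}$ be an infinite sequence generated by the SSAL method and let $(\hat x,\hat y,\hat\lambda)$ be any accumulation point of it. Let $J=\{1\le j\le n:\hat x_j\ne 0\}$, let $\bar J$ be its complement in $\{1,\dots,n\}$, and let $r=|J|$. Assume that: (i) $\{\lambda^k\}$ is bounded; (ii) $\lim_{k\to\infty}\big[(x^{k+1},y^{k+1},\lambda^{k+1})-(x^k,y^k,\lambda^k)\big]=0$; (iii) the Robinson condition holds at $\hat x$ for $J$, that is, with $A(\hat x)=\{i\in J:\hat x_i=b_i\}$ and $B(\hat x)=\{i\in J:\hat x_i=a_i\}$, $$\left\{\begin{pmatrix} d_{J}-s\\ -d_{J}-t\\ d_{\bar J}\end{pmatrix}\ \Bigg|\ d\in T_X(\hat x),\ s,t\in\mathbb{R}^{r},\ s_{A(\hat x)}\le 0,\ t_{B(\hat x)}\le 0\right\}=\mathbb{R}^{n+r},$$ where the entries of $s,t$ are indexed by $J$. Then $\hat x$ satisfies the first order stationary conditions: there exists $(\hat\nu,\hat\eta,\hat\kappa)\in\mathbb{R}^n\times\mathbb{R}^n\times\mathbb{R}^n$ such that $$0\in\nabla f(\hat x)+\hat\nu-\hat\eta+\hat\kappa+N_X(\hat x),$$ $$\hat\nu_i\ge0,\quad\hat\eta_i\ge0,\quad\hat\nu_i(\hat x_i-b_i)=0,\quad\hat\eta_i(-a_i+\hat x_i)=0,\qquad i=1,\dots,n,$$ $$\hat\kappa_j=0,\qquad j\in J.$$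
   Context: Standing assumptions: $f:\mathbb{R}^n\to\mathbb{R}$ is a continuously differentiable convex function; $X\subseteq\mathbb{R}^n$ is a closed convex set with nonempty interior; $0<K<n$; $0<a_i<b_i$ for $i=1,\dots,n$. $\|x\|_0$ is the number of nonzero entries of $x$, $\|\cdot\|$ the Euclidean norm, $x_L$ the subvector of $x$ indexed by $L$, and $T_X(x)$, $N_X(x)$ the tangent and normal cones of $X$ at $x\in X$. The underlying problem is: minimize $f(x)$ subject to $x\in X$, $\|x\|_0\le K$, $x_i\in\{0\}\cup[a_i,b_i]$ for all $i$. Let $$Y=\{y\in\mathbb{R}^n:\ \|y\|_0\le K,\ y_i\in\{0\}\cup[a_i,b_i],\ i=1,\dots,n\},$$ $$L_\rho(x,y,\lambda)=f(x)+\lambda^T(y-x)+\frac{\rho}{2}\|y-x\|^2.$$ SSAL method: choose $\lambda^0\in\mathbb{R}^n$, a penalty parameter $\rho>0$, a step-size $\omega>0$ and $y^0\in Y$; let $x^0$ minimize $L_\rho(x,y^0,\lambda^0)$ over $x\in X$. For $k=0,1,2,\dots$: (1) $y^{k+1}\in\operatorname{argmin}_{y\in Y}L_\rho(x^k,y,\lambda^k)$, computed explicitly as follows: with $w=x^k-\frac1\rho\lambda^k$, $r_i=\min_{a_i\le y_i\le b_i}(y_i-w_i)^2$, $v_i=r_i-w_i^2$, and after reordering the indices so that $v_1\le\dots\le v_n$, set $z_i^{k+1}=1$ if $i\le K$ and $v_i\le 0$, $z_i^{k+1}=0$ otherwise, and $y_i^{k+1}=z_i^{k+1}\min\{b_i,\max\{w_i,a_i\}\}$;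 (2) $x^{k+1}=\operatorname{argmin}_{x\in X}L_\rho(x,y^{k+1},\lambda^k)$; (3) $\lambda_i^{k+1}=\lambda_i^k+\omega\rho\,[y_i^{k+1}-x_i^{k+1}]$, $i=1,\dots,n$. *)

theory Defs
  imports "HOL-Analysis.Analysis" "HOL-Library.FuncSet"
begin

definition vec_support :: "real^'n \<Rightarrow> 'n set" where
  "vec_support x = {i. x $ i \<noteq> 0}"

definition l0_norm :: "real^'n \<Rightarrow> nat" where
  "l0_norm x = card (vec_support x)"

(* Contingent (Bouligand) cone. For convex X it coincides with the closure of the cone
   generated by X - x. *)
definition tangent_cone :: "'a::real_normed_vector set \<Rightarrow> 'a \<Rightarrow> 'a set" where
  "tangent_cone X x =
     {d. \<exists>(u :: nat \<Rightarrow> 'a) (\<tau> :: nat \<Rightarrow> real).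
           (\<forall>k. u k \<in> X) \<and> (\<forall>k. 0 < \<tau> k) \<and> u \<longlonglongrightarrow> x \<and> \<tau> \<longlonglongrightarrow> 0 \<and>
           (\<lambda>k. (u k - x) /\<^sub>R \<tau> k) \<longlonglongrightarrow> d}"

(* The normal cone of convex analysis, used only at points x of a convex set X. *)
definition normal_cone :: "'a::real_inner set \<Rightarrow> 'a \<Rightarrow> 'a set" where
  "normal_cone X x = {v. \<forall>u\<in>X. v \<bullet> (u - x) \<le> 0}"

definition Y_set :: "nat \<Rightarrow> real^'n \<Rightarrow> real^'n \<Rightarrow> (real^'n) set" where
  "Y_set K a b = {y. l0_norm y \<le> K \<and> (\<forall>i. y $ i \<in> {0} \<union> {a $ i .. b $ i})}"

definition aug_lagrangian ::
  "(real^'n \<Rightarrow> real) \<Rightarrow> real \<Rightarrow> real^'n \<Rightarrow> real^'n \<Rightarrow> real^'n \<Rightarrow> real" where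
  "aug_lagrangian f \<rho> x y lam = f x + lam \<bullet> (y - x) + \<rho> / 2 * (norm (y - x))\<^sup>2"

(* The closed-form y-step, at the current x and multiplier lam. The infimum defining r is
   attained because {a $ i .. b $ i} is compact and nonempty. The bijection \<sigma> is the reordering
   of the coordinates: \<sigma> j is the index in position j. Ties may be broken arbitrarily, and
   differently in each iteration. *)
definition explicit_y_step ::
  "nat \<Rightarrow> real^'n \<Rightarrow> real^'n \<Rightarrow> real \<Rightarrow> real^'n \<Rightarrow> real^'n \<Rightarrow> real^'n \<Rightarrow> bool" where
  "explicit_y_step K a b \<rho> x lam y \<longleftrightarrow>
     (let w = x - (1 / \<rho>) *\<^sub>R lam;
          r = (\<lambda>i. INF t\<in>{a $ i .. b $ i}. (t - w $ i)\<^sup>2);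
          v = (\<lambda>i. r i - (w $ i)\<^sup>2)
      in \<exists>(\<sigma> :: nat \<Rightarrow> 'n) (z :: 'n \<Rightarrow> real).
           bij_betw \<sigma> {1..CARD('n)} UNIV \<and>
           mono_on {1..CARD('n)} (\<lambda>j. v (\<sigma> j)) \<and>
           (\<forall>j\<in>{1..CARD('n)}. z (\<sigma> j) = (if j \<le> K \<and> v (\<sigma> j) \<le> 0 then 1 else 0)) \<and>
           (\<forall>i. y $ i = z i * min (b $ i) (max (w $ i) (a $ i))))"

(* The minimality of y (Suc k) over Y_set is kept next to the closed form, as in the description
   of the method; the closed form implies it. Minimisers over X are unique for convex f and
   positive \<rho>, so is_arg_min determines x k. *)
definition SSAL_sequence ::
  "(real^'n \<Rightarrow> real) \<Rightarrow> (real^'n) set \<Rightarrow> nat \<Rightarrow> real^'n \<Rightarrow> real^'n \<Rightarrow> real \<Rightarrow> real \<Rightarrow>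
   (nat \<Rightarrow> real^'n) \<Rightarrow> (nat \<Rightarrow> real^'n) \<Rightarrow> (nat \<Rightarrow> real^'n) \<Rightarrow> bool" where
  "SSAL_sequence f X K a b \<rho> \<omega> x y lam \<longleftrightarrow>
     y 0 \<in> Y_set K a b \<and>
     is_arg_min (\<lambda>u. aug_lagrangian f \<rho> u (y 0) (lam 0)) (\<lambda>u. u \<in> X) (x 0) \<and>
     (\<forall>k.
        is_arg_min (\<lambda>u. aug_lagrangian f \<rho> (x k) u (lam k)) (\<lambda>u. u \<in> Y_set K a b) (y (Suc k)) \<and>
        explicit_y_step K a b \<rho> (x k) (lam k) (y (Suc k)) \<and>
        is_arg_min (\<lambda>u. aug_lagrangian f \<rho> u (y (Suc k)) (lam k)) (\<lambda>u. u \<in> X) (x (Suc k)) \<and>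
        (\<forall>i. lam (Suc k) $ i = lam k $ i + \<omega> * \<rho> * (y (Suc k) $ i - x (Suc k) $ i)))"

(* The space of dimension n + r, where r = card J, is rendered as R^J x R^J x R^(-J). Its
   factors consist of the extensional functions on the respective index set. *)
definition robinson_condition ::
  "(real^'n) set \<Rightarrow> real^'n \<Rightarrow> real^'n \<Rightarrow> 'n set \<Rightarrow> real^'n \<Rightarrow> bool" where
  "robinson_condition X a b J x \<longleftrightarrow>
     (let A = {i\<in>J. x $ i = b $ i}; B = {i\<in>J. x $ i = a $ i}
      in {(restrict (\<lambda>i. d $ i - s i) J, restrict (\<lambda>i. - d $ i - t i) J, restrict (\<lambda>i. d $ i) (- J))
            | d s t. d \<in> tangent_cone X x \<and>
                     s \<in> J \<rightarrow>\<^sub>E UNIV \<and> t \<in> J \<rightarrow>\<^sub>E UNIV \<and>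
                     (\<forall>i\<in>A. s i \<le> 0) \<and> (\<forall>i\<in>B. t i \<le> 0)}
         = (J \<rightarrow>\<^sub>E (UNIV :: real set)) \<times> (J \<rightarrow>\<^sub>E (UNIV :: real set)) \<times> (- J \<rightarrow>\<^sub>E (UNIV :: real set)))"

end

theory Submission
  imports Defs
begin

text \<open>
  The multiplier update and the vanishing increments force \<open>y k - x k\<close> to tend to 0, so both
  sequences accumulate at \<open>xh\<close>. Passing to the limit in the variational inequality of the
  \<open>x\<close>-step shows that \<open>lamh - gradf xh\<close> lies in the normal cone. Passing to the limit in the
  clamping formula of the \<open>y\<close>-step determines the sign of \<open>lamh $ j\<close> for \<open>j \<in> J\<close>, according
  to whether \<open>xh $ j\<close> is at the upper bound, at the lower bound or strictly between. Hence
  \<open>- lamh\<close> splits into the three multipliers; its entries outside \<open>J\<close> are absorbed by \<open>\<kappa>\<close>.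
\<close>

text \<open>If the directional derivative along \<open>u - x\<close> were negative, a short step
  from \<open>x\<close> towards \<open>u\<close>, which stays in \<open>X\<close> by convexity,
  would push \<open>g\<close> below its minimum.\<close>

lemma gderiv_minimizer_variational_inequality:
  fixes g :: "'a::real_inner \<Rightarrow> real"
  assumes deriv: "GDERIV g x :> D" and "convex X" and "x \<in> X" and "u \<in> X"
    and min: "\<And>v. v \<in> X \<Longrightarrow> g x \<le> g v"
  shows "0 \<le> D \<bullet> (u - x)"
proof (rule ccontr)
  assume neg: "\<not> 0 \<le> D \<bullet> (u - x)"
  let ?h = "\<lambda>t::real. g (x + t *\<^sub>R (u - x))"
  have "((\<lambda>t. x + t *\<^sub>R (u - x)) has_derivative (\<lambda>t. t *\<^sub>R (u - x))) (at (0::real))"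
    by (auto intro!: derivative_eq_intros)
  moreover have "(g has_derivative (\<lambda>h. h \<bullet> D)) (at (x + 0 *\<^sub>R (u - x)))"
    using deriv by (simp add: gderiv_def)
  ultimately have "(?h has_derivative (\<lambda>t. (t *\<^sub>R (u - x)) \<bullet> D)) (at 0)"
    by (rule has_derivative_compose)
  moreover have "(\<lambda>t. (t *\<^sub>R (u - x)) \<bullet> D) = (*) (D \<bullet> (u - x))"
    by (auto simp: fun_eq_iff inner_commute)
  ultimately have "DERIV ?h 0 :> D \<bullet> (u - x)"
    by (simp add: has_field_derivative_def)
  then obtain \<delta> where "\<delta> > 0" and dec: "\<And>h. 0 < h \<Longrightarrow> h < \<delta> \<Longrightarrow> ?h (0 + h) < ?h 0"
    using DERIV_neg_dec_right[of ?h "D \<bullet> (u - x)" 0] neg by (auto simp: not_le)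
  \<comment> \<open>The cap at 1 makes the new point a convex combination of \<open>x\<close> and
    \<open>u\<close>; halving \<open>\<delta>\<close> keeps the step strictly inside the range of
    descent.\<close>
  define t where "t = min 1 (\<delta> / 2)"
  have t: "0 < t" "t < \<delta>" "t \<le> 1" using \<open>\<delta> > 0\<close> by (auto simp: t_def)
  have "x + t *\<^sub>R (u - x) = (1 - t) *\<^sub>R x + t *\<^sub>R u" by (simp add: algebra_simps)
  also have "\<dots> \<in> X"
    using t \<open>convex X\<close> \<open>x \<in> X\<close> \<open>u \<in> X\<close> by (auto intro: convexD)
  finally show False using min dec[of t] t by fastforce
qed

lemma GDERIV_aug_lagrangian:
  assumes "GDERIV f u :> D"
  shows "GDERIV (\<lambda>u. aug_lagrangian f \<rho> u y lam) u :> D - lam - \<rho> *\<^sub>R (y - u)"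
  using assms unfolding gderiv_def aug_lagrangian_def power2_norm_eq_inner
  by (auto intro!: derivative_eq_intros simp: fun_eq_iff inner_simps inner_commute algebra_simps)

text \<open>Each entry is the clamped value times a switch in {0, 1}, so a nonzero entry has its
  switch on. \<open>P\<close> abstracts the selection rule.\<close>

lemma explicit_y_step_nonzeroD:
  assumes "explicit_y_step K a b \<rho> x lam y" and "y $ i \<noteq> 0"
  shows "y $ i = min (b $ i) (max (x $ i - lam $ i / \<rho>) (a $ i))"
proof -
  let ?c = "min (b $ i) (max (x $ i - lam $ i / \<rho>) (a $ i))"
  obtain \<sigma> :: "nat \<Rightarrow> 'a" and z P
    where bij: "bij_betw \<sigma> {1..CARD('a)} UNIV"
      and z: "\<forall>j\<in>{1..CARD('a)}. z (\<sigma> j) = (if P j then 1 else 0)"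
      and y: "y $ i = z i * ?c"
    using assms(1) unfolding explicit_y_step_def Let_def by (auto simp: field_simps)
  \<comment> \<open>Surjectivity of the reordering gives index \<open>i\<close> a position, where
    the switch is prescribed.\<close>
  obtain j where "j \<in> {1..CARD('a)}" "i = \<sigma> j"
    using bij by (metis UNIV_I bij_betw_imp_surj_on imageE)
  with z have "z i = 0 \<or> z i = 1" by auto
  with y assms(2) show ?thesis by auto
qed

theorem theorem4p3:
  fixes f :: "real^'n \<Rightarrow> real" and gradf :: "real^'n \<Rightarrow> real^'n"
    and X :: "(real^'n) set" and K :: nat and a b :: "real^'n" and \<rho> \<omega> :: real
    and x y lam :: "nat \<Rightarrow> real^'n" and xh yh lamh :: "real^'n" and J :: "'n set"
  assumes "\<And>u. GDERIV f u :> gradf u" and "continuous_on UNIV gradf"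
    and "convex_on UNIV f"
    and "closed X" and "convex X" and "interior X \<noteq> {}"
    and "0 < K" and "K < CARD('n)"
    and "\<And>i. 0 < a $ i" and "\<And>i. a $ i < b $ i"
    and "\<rho> > 0" and "\<omega> > 0"
    and "SSAL_sequence f X K a b \<rho> \<omega> x y lam"
    and accumulation: "\<exists>\<phi>. strict_mono (\<phi> :: nat \<Rightarrow> nat) \<and>
      (\<lambda>k. (x (\<phi> k), y (\<phi> k), lam (\<phi> k))) \<longlonglongrightarrow> (xh, yh, lamh)"
    and J: "J = {j. xh $ j \<noteq> 0}"
    and "bounded (range lam)"
    and "(\<lambda>k. (x (Suc k), y (Suc k), lam (Suc k)) - (x k, y k, lam k)) \<longlonglongrightarrow> 0"
    and "robinson_condition X a b J xh"
  shows "\<exists>\<nu> \<eta> \<kappa> :: real^'n.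
      0 \<in> (\<lambda>v. gradf xh + \<nu> - \<eta> + \<kappa> + v) ` normal_cone X xh \<and>
      (\<forall>i. 0 \<le> \<nu> $ i \<and> 0 \<le> \<eta> $ i \<and>
           \<nu> $ i * (xh $ i - b $ i) = 0 \<and> \<eta> $ i * (- (a $ i) + xh $ i) = 0) \<and>
      (\<forall>j\<in>J. \<kappa> $ j = 0)"
proof -
  have lam_step: "\<And>k. lam (Suc k) - lam k = (\<omega> * \<rho>) *\<^sub>R (y (Suc k) - x (Suc k))"
    and x_min: "\<And>k. is_arg_min (\<lambda>u. aug_lagrangian f \<rho> u (y (Suc k)) (lam k)) (\<lambda>u. u \<in> X) (x (Suc k))"
    and y_step: "\<And>k. explicit_y_step K a b \<rho> (x k) (lam k) (y (Suc k))"
    using \<open>SSAL_sequence f X K a b \<rho> \<omega> x y lam\<close>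
    by (auto simp: SSAL_sequence_def vec_eq_iff)
  obtain \<phi> :: "nat \<Rightarrow> nat" where "strict_mono \<phi>"
    and acc: "(\<lambda>k. (x (\<phi> k), y (\<phi> k), lam (\<phi> k))) \<longlonglongrightarrow> (xh, yh, lamh)"
    using accumulation by blast
  have x_lim: "(\<lambda>k. x (\<phi> k)) \<longlonglongrightarrow> xh" and y_lim: "(\<lambda>k. y (\<phi> k)) \<longlonglongrightarrow> yh"
    and lam_lim: "(\<lambda>k. lam (\<phi> k)) \<longlonglongrightarrow> lamh"
    using tendsto_fst[OF acc] tendsto_fst[OF tendsto_snd[OF acc]] tendsto_snd[OF tendsto_snd[OF acc]]
    by simp_all
  have incr: "(\<lambda>k. (x (Suc (\<phi> k)) - x (\<phi> k), y (Suc (\<phi> k)) - y (\<phi> k), lam (Suc (\<phi> k)) - lam (\<phi> k)))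
      \<longlonglongrightarrow> (0, 0, 0)"
    using LIMSEQ_subseq_LIMSEQ[OF assms(17) \<open>strict_mono \<phi>\<close>] by (simp add: o_def zero_prod_def)
  have x_Suc_lim: "(\<lambda>k. x (Suc (\<phi> k))) \<longlonglongrightarrow> xh"
    using tendsto_add[OF x_lim tendsto_fst[OF incr]] by simp
  have y_Suc_lim': "(\<lambda>k. y (Suc (\<phi> k))) \<longlonglongrightarrow> yh"
    using tendsto_add[OF y_lim tendsto_fst[OF tendsto_snd[OF incr]]] by simp
  \<comment> \<open>The infeasibility \<open>y - x\<close> is the multiplier increment divided by
    \<open>\<omega> * \<rho>\<close>, so it vanishes along with it.\<close>
  have "(\<lambda>k. (1 / (\<omega> * \<rho>)) *\<^sub>R (lam (Suc (\<phi> k)) - lam (\<phi> k))) \<longlonglongrightarrow> (1 / (\<omega> * \<rho>)) *\<^sub>R 0"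
    using tendsto_snd[OF tendsto_snd[OF incr]] by (intro tendsto_scaleR tendsto_const) simp
  then have "(\<lambda>k. y (Suc (\<phi> k)) - x (Suc (\<phi> k))) \<longlonglongrightarrow> 0"
    using \<open>\<rho> > 0\<close> \<open>\<omega> > 0\<close> by (simp add: lam_step)
  with tendsto_diff[OF y_Suc_lim' x_Suc_lim] have "yh - xh = 0"
    by (rule LIMSEQ_unique)
  with y_Suc_lim' have y_Suc_lim: "(\<lambda>k. y (Suc (\<phi> k))) \<longlonglongrightarrow> xh" by simp

  have normal: "lamh - gradf xh \<in> normal_cone X xh"
    unfolding normal_cone_def
  proof (intro CollectI ballI)
    fix u assume "u \<in> X"
    \<comment> \<open>The gradient of the function minimised in the \<open>x\<close>-step. Its
      multiplier is the one before the update; its penalty term vanishes in the limit.\<close>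
    let ?D = "\<lambda>k. gradf (x (Suc (\<phi> k))) - lam (\<phi> k) - \<rho> *\<^sub>R (y (Suc (\<phi> k)) - x (Suc (\<phi> k)))"
    have "0 \<le> ?D k \<bullet> (u - x (Suc (\<phi> k)))" for k
      using x_min[of "\<phi> k"] \<open>u \<in> X\<close>
      by (intro gderiv_minimizer_variational_inequality[OF GDERIV_aug_lagrangian[OF assms(1)] \<open>convex X\<close>])
        (auto simp: is_arg_min_linorder)
    moreover have "(\<lambda>k. gradf (x (Suc (\<phi> k)))) \<longlonglongrightarrow> gradf xh"
      using continuous_on_tendsto_compose[OF \<open>continuous_on UNIV gradf\<close> x_Suc_lim] by simp
    then have "(\<lambda>k. ?D k \<bullet> (u - x (Suc (\<phi> k))))
        \<longlonglongrightarrow> (gradf xh - lamh - \<rho> *\<^sub>R (xh - xh)) \<bullet> (u - xh)"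
      by (intro tendsto_intros lam_lim y_Suc_lim x_Suc_lim)
    ultimately have "0 \<le> (gradf xh - lamh - \<rho> *\<^sub>R (xh - xh)) \<bullet> (u - xh)"
      by (meson LIMSEQ_le_const)
    then show "(lamh - gradf xh) \<bullet> (u - xh) \<le> 0" by (simp add: inner_diff_left)
  qed

  have clamp: "xh $ j = min (b $ j) (max (xh $ j - lamh $ j / \<rho>) (a $ j))" if "j \<in> J" for j
  proof (rule LIMSEQ_unique)
    show y_j: "(\<lambda>k. y (Suc (\<phi> k)) $ j) \<longlonglongrightarrow> xh $ j"
      by (intro tendsto_intros y_Suc_lim)
    \<comment> \<open>Since \<open>xh $ j\<close> is nonzero, these entries are eventually nonzero
      too, which makes the clamping formula available.\<close>
    have "eventually (\<lambda>k. y (Suc (\<phi> k)) $ j \<noteq> 0) sequentially"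
      using tendsto_imp_eventually_ne[OF y_j] that J by simp
    then have "eventually (\<lambda>k. min (b $ j) (max (x (\<phi> k) $ j - lam (\<phi> k) $ j / \<rho>) (a $ j))
        = y (Suc (\<phi> k)) $ j) sequentially"
      by eventually_elim (rule explicit_y_step_nonzeroD[OF y_step, symmetric])
    moreover have "(\<lambda>k. min (b $ j) (max (x (\<phi> k) $ j - lam (\<phi> k) $ j / \<rho>) (a $ j)))
        \<longlonglongrightarrow> min (b $ j) (max (xh $ j - lamh $ j / \<rho>) (a $ j))"
      using \<open>\<rho> > 0\<close> by (intro tendsto_intros x_lim lam_lim) auto
    ultimately show "(\<lambda>k. y (Suc (\<phi> k)) $ j)
        \<longlonglongrightarrow> min (b $ j) (max (xh $ j - lamh $ j / \<rho>) (a $ j))"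
      by (simp add: tendsto_cong)
  qed
  have signs: "lamh $ j \<le> 0 \<or> xh $ j = a $ j" "0 \<le> lamh $ j \<or> xh $ j = b $ j" if "j \<in> J" for j
  proof -
    have "lamh $ j / \<rho> \<le> 0 \<longleftrightarrow> lamh $ j \<le> 0" "0 \<le> lamh $ j / \<rho> \<longleftrightarrow> 0 \<le> lamh $ j"
      using \<open>\<rho> > 0\<close> by (simp_all add: divide_le_0_iff zero_le_divide_iff)
    \<comment> \<open>If \<open>lamh $ j > 0\<close>, the unclamped value lies below
      \<open>xh $ j\<close>, so clamping must have raised it to \<open>a $ j\<close>; if
      \<open>lamh $ j < 0\<close>, it must have lowered it to \<open>b $ j\<close>.\<close>
    with clamp[OF that] assms(10)[of j]
    show "lamh $ j \<le> 0 \<or> xh $ j = a $ j" "0 \<le> lamh $ j \<or> xh $ j = b $ j"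
      by linarith+
  qed

  \<comment> \<open>On \<open>J\<close>, the negative and positive parts of \<open>lamh\<close>. Off
    \<open>J\<close>, where \<open>xh $ i = 0 < a $ i < b $ i\<close>, complementarity forces both
    to be 0, and \<open>?\<kappa>\<close> takes the whole entry.\<close>
  let ?\<nu> = "\<chi> i. if i \<in> J then max 0 (- lamh $ i) else 0"
  let ?\<eta> = "\<chi> i. if i \<in> J then max 0 (lamh $ i) else 0"
  let ?\<kappa> = "\<chi> i. if i \<in> J then 0 else - lamh $ i"
  have "0 = gradf xh + ?\<nu> - ?\<eta> + ?\<kappa> + (lamh - gradf xh)"
    by (simp add: vec_eq_iff max_def)
  with normal have "0 \<in> (\<lambda>v. gradf xh + ?\<nu> - ?\<eta> + ?\<kappa> + v) ` normal_cone X xh"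
    by blast
  moreover have "\<forall>i. 0 \<le> ?\<nu> $ i \<and> 0 \<le> ?\<eta> $ i \<and>
      ?\<nu> $ i * (xh $ i - b $ i) = 0 \<and> ?\<eta> $ i * (- (a $ i) + xh $ i) = 0"
    using signs by (fastforce simp: max_def)
  moreover have "\<forall>j\<in>J. ?\<kappa> $ j = 0" by simp
  ultimately show ?thesis by blast
qed

end
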